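(* Let $f:\mathbb{R}^n\to\mathbb{R}$ and let $Z$ assign to each $\mathbf{x}\in\mathbb{R}^n$ an invertible matrix $Z(\mathbf{x})\in\mathbb{R}^{n\times n}$. Assume: (A1) $f\in C^2$ and $\inf_{\mathbf{x}\in\mathbb{R}^n} f(\mathbf{x})>-R$ for some $R>0$; (A2) $f$ is coercive, i.e. $\lim_{\|\mathbf{x}\|\to\infty} f(\mathbf{x})=+\infty$; (A3) the Hessian $\nabla^2 f(\mathbf{x})$ is non-degenerate (for every $\mathbf{x}$); (A4) there are $L, B>0$ such that for all $\mathbf{x},\mathbf{y}\in\mathbb{R}^n$, $\|\nabla f(\mathbf{x})-\nabla f(\mathbf{y})\|\le L\|\mathbf{x}-\mathbf{y}\|$ and $\|\nabla f(\mathbf{x})\|\le B$; (A5) $Z(\mathbf{x})^{-1}$ is diagonal for all $\mathbf{x}$, and there are $d_1,d_2>0$ such that $d_2>(Z(\mathbf{x})^{-1})_{ii}>d_1$ for all $i\in\{1,\dots,n\}$ and all $\mathbf{x}\in\mathbb{R}^n$. Let $\mathbf{x}_0\in\mathbb{R}^n$ and let $\mathbf{x}:[0,\infty)\to\mathbb{R}^n$ be a solution of the initial value problem $$\dot{\mathbf{x}}(t)=-Z(\mathbf{x}(t))^{-1}\nabla f(\mathbf{x}(t)),\qquad \mathbf{x}(0)=\mathbf{x}_0.$$ Then $$\lim_{t\to\infty}\|\nabla f(\mathbf{x}(t))\|=0.$$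
   Context: $\|\cdot\|$ denotes the Euclidean norm, $\nabla f$ the gradient, $\nabla^2 f$ the Hessian, and $\dot{\mathbf{x}}(t)$ the time derivative of $\mathbf{x}(t)$. The function $f$ is not assumed convex. The initial value problem is called component-wise scaled gradient flow. *)

theory Defs
  imports "HOL-Analysis.Analysis"
begin

definition gradient :: "(real ^ 'n \<Rightarrow> real) \<Rightarrow> real ^ 'n \<Rightarrow> real ^ 'n" where
  "gradient f x = (THE D. GDERIV f x :> D)"

lemma gradient_eqI:
  assumes "GDERIV f x :> D"
  shows "gradient f x = D"
  unfolding gradient_def
proof (rule the_equality)
  show "GDERIV f x :> D"
    by (fact assms)
next
  fix D' assume "GDERIV f x :> D'"
  with assms have "(\<lambda>h. h \<bullet> D') = (\<lambda>h. h \<bullet> D)"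
    unfolding gderiv_def by (blast intro: has_derivative_unique)
  then have "\<And>h. h \<bullet> D' = h \<bullet> D"
    by meson
  then show "D' = D"
    using vector_eq_ldot [of D' D] by blast
qed

lemma GDERIV_gradient:
  fixes f :: "real ^ 'n \<Rightarrow> real"
  assumes "f differentiable (at x)"
  shows "GDERIV f x :> gradient f x"
proof -
  obtain f' where f': "(f has_derivative f') (at x)"
    using assms unfolding differentiable_def by blast
  then have lin: "linear f'"
    by (rule has_derivative_linear)
  have "f' = (\<lambda>h. h \<bullet> adjoint f' 1)"
    using adjoint_works [OF lin, of _ 1] by (intro ext) simp
  with f' have "GDERIV f x :> adjoint f' 1"
    unfolding gderiv_def by simp
  then show ?thesis
    using gradient_eqI by metis
qed

text \<open>The \<open>(i, j)\<close> entry is the \<open>j\<close>-th partial derivative of the \<open>i\<close>-th component of the gradient.\<close>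

definition hessian :: "(real ^ 'n \<Rightarrow> real) \<Rightarrow> real ^ 'n \<Rightarrow> real ^ 'n ^ 'n" where
  "hessian f x = jacobian (gradient f) (at x)"

text \<open>
  Both \<open>gradient\<close> and \<open>hessian\<close> have unspecified values where the derivative does not
  exist, so differentiability is required explicitly. Continuity of \<open>f\<close> and of its gradient
  follows from their differentiability.
\<close>

definition C2 :: "(real ^ 'n \<Rightarrow> real) \<Rightarrow> bool" where
  "C2 f \<longleftrightarrow>
     (\<forall>x. f differentiable (at x)) \<and>
     (\<forall>x. gradient f differentiable (at x)) \<and>
     continuous_on UNIV (hessian f)"

end

(*
  Along the flow, f decreases at rate at least d1 * |grad f|^2, while f is bounded below and
  |grad f| is Lipschitz in time because the speed is at most d2 * B. If |grad f| were at least
  e at a late time, it would stay above e/2 for a fixed duration, forcing f to drop by a fixed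
  amount, which is impossible once f is close to its infimum along the trajectory.
*)
theory Submission
  imports Defs
begin

text \<open>A scalar statement in the spirit of Barbalat's lemma, separated from the geometry:
  \<open>\<phi>\<close> is to be \<open>f\<close> along the trajectory and \<open>g\<close> the
  gradient norm. An energy that is bounded below can only pay for finitely many time windows of
  fixed length on which \<open>g\<close> stays away from 0.\<close>

lemma dissipation_tendsto_zero:
  fixes \<phi> \<phi>' g :: "real \<Rightarrow> real"
  assumes deriv: "\<And>t. t \<ge> 0 \<Longrightarrow> (\<phi> has_real_derivative \<phi>' t) (at t within {0..})"
    and dissipation: "\<And>t. t \<ge> 0 \<Longrightarrow> \<phi>' t \<le> - c * (g t)\<^sup>2"
    and "c > 0"
    and lipschitz: "\<And>s t. 0 \<le> s \<Longrightarrow> s \<le> t \<Longrightarrow> \<bar>g t - g s\<bar> \<le> K * (t - s)"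
    and bdd: "bdd_below (\<phi> ` {0..})"
  shows "(g \<longlongrightarrow> 0) at_top"
proof -
  \<comment> \<open>The sign of \<open>K\<close> is unknown; enlarging it to a positive constant
    keeps the Lipschitz bound and permits division by it in \<open>h\<close>.\<close>
  define K' where "K' = max K 1"
  have "K' > 0"
    by (simp add: K'_def)
  have lipschitz': "\<bar>g t - g s\<bar> \<le> K' * (t - s)" if "0 \<le> s" "s \<le> t" for s t
  proof -
    have "K * (t - s) \<le> K' * (t - s)"
      using that by (intro mult_right_mono) (auto simp: K'_def)
    with lipschitz [OF that] show ?thesis
      by linarith
  qed
  \<comment> \<open>The mean value theorem takes the place of integrating \<open>\<phi>'\<close>,
    about whose continuity or integrability nothing is assumed.\<close>
  have mvt: "\<exists>\<xi>\<in>{s<..<t}. \<phi> t - \<phi> s = \<phi>' \<xi> * (t - s)" if "0 \<le> s" "s < t" for s t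
  proof (rule mvt_simple [OF \<open>s < t\<close>])
    fix \<xi> assume "s \<le> \<xi>" "\<xi> \<le> t"
    with that have "(\<phi> has_real_derivative \<phi>' \<xi>) (at \<xi> within {s..t})"
      by (intro DERIV_subset [OF deriv]) auto
    then show "(\<phi> has_derivative (*) (\<phi>' \<xi>)) (at \<xi> within {s..t})"
      by (simp add: has_field_derivative_def)
  qed
  have antimono: "\<phi> t \<le> \<phi> s" if "0 \<le> s" "s \<le> t" for s t
  proof (cases "s = t")
    case False
    with that obtain \<xi> where \<xi>: "\<xi> \<in> {s<..<t}" "\<phi> t - \<phi> s = \<phi>' \<xi> * (t - s)"
      using mvt [of s t] by auto
    have "\<phi>' \<xi> \<le> - c * (g \<xi>)\<^sup>2"
      using \<xi> that by (intro dissipation) auto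
    also have "\<dots> \<le> 0"
      using \<open>c > 0\<close> by simp
    finally have "\<phi>' \<xi> * (t - s) \<le> 0"
      using that by (simp add: mult_nonpos_nonneg)
    with \<xi> show ?thesis
      by linarith
  qed simp
  show ?thesis
  proof (rule tendstoI)
    fix e :: real assume "e > 0"
    \<comment> \<open>Within time \<open>h\<close> the Lipschitz bound lets \<open>g\<close> change
      by at most \<open>e / 2\<close>; \<open>\<delta>\<close> is then the drop of
      \<open>\<phi>\<close> forced over such a window when |g| is at least \<open>e\<close> at its
      start.\<close>
    define h where "h = e / (2 * K')"
    define \<delta> where "\<delta> = c * (e / 2)\<^sup>2 * h"
    have "h > 0"
      using \<open>e > 0\<close> \<open>K' > 0\<close> by (simp add: h_def)
    then have "\<delta> > 0"
      using \<open>e > 0\<close> \<open>c > 0\<close> by (simp add: \<delta>_def)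
    then have "Inf (\<phi> ` {0..}) < Inf (\<phi> ` {0..}) + \<delta>"
      by simp
    then obtain T where T: "T \<ge> 0" "\<phi> T < Inf (\<phi> ` {0..}) + \<delta>"
      using cInf_lessD [of "\<phi> ` {0..}" "Inf (\<phi> ` {0..}) + \<delta>"] by auto
    have "\<bar>g t\<bar> < e" if "t \<ge> T" for t
    proof (rule ccontr)
      assume "\<not> \<bar>g t\<bar> < e"
      have "t \<ge> 0"
        using T that by simp
      obtain \<xi> where \<xi>: "\<xi> \<in> {t<..<t + h}" "\<phi> (t + h) - \<phi> t = \<phi>' \<xi> * h"
        using mvt [of t "t + h"] \<open>t \<ge> 0\<close> \<open>h > 0\<close> by auto
      \<comment> \<open>It is enough to control \<open>g\<close> at the single intermediate point
        \<open>\<xi>\<close>, which lies within \<open>h\<close> of \<open>t\<close>.\<close>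
      have "K' * (\<xi> - t) \<le> K' * h"
        using \<xi> \<open>K' > 0\<close> by (intro mult_left_mono) auto
      also have "\<dots> = e / 2"
        using \<open>K' > 0\<close> by (simp add: h_def)
      finally have "\<bar>g \<xi> - g t\<bar> \<le> e / 2"
        using lipschitz' [of t \<xi>] \<open>t \<ge> 0\<close> \<xi> by auto
      then have "e / 2 \<le> \<bar>g \<xi>\<bar>"
        using \<open>\<not> \<bar>g t\<bar> < e\<close> by linarith
      then have "(e / 2)\<^sup>2 \<le> (g \<xi>)\<^sup>2"
        using \<open>e > 0\<close> by (metis abs_le_square_iff abs_of_pos half_gt_zero)
      then have "c * (e / 2)\<^sup>2 \<le> c * (g \<xi>)\<^sup>2"
        using \<open>c > 0\<close> by (intro mult_left_mono) auto
      with dissipation [of \<xi>] \<xi> \<open>t \<ge> 0\<close> have "\<phi>' \<xi> \<le> - (c * (e / 2)\<^sup>2)"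
        by auto
      then have "\<phi>' \<xi> * h \<le> - \<delta>"
        unfolding \<delta>_def using \<open>h > 0\<close>
        by (metis less_eq_real_def mult_minus_left mult_right_mono)
      \<comment> \<open>By monotonicity \<open>\<phi>\<close> is still within
        \<open>\<delta>\<close> of its infimum at time \<open>t\<close>, so a further drop by
        \<open>\<delta>\<close> would take \<open>\<phi> (t + h)\<close> below the infimum.\<close>
      moreover have "\<phi> t \<le> \<phi> T"
        using T that by (intro antimono)
      moreover have "Inf (\<phi> ` {0..}) \<le> \<phi> (t + h)"
        using \<open>t \<ge> 0\<close> \<open>h > 0\<close> by (intro cInf_lower bdd) auto
      ultimately show False
        using T \<xi> by linarith
    qed
    then show "\<forall>\<^sub>F t in at_top. dist (g t) 0 < e"
      by (auto simp: eventually_at_top_linorder)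
  qed
qed

lemma diagonal_matrix_vector_mult_component:
  fixes A :: "real ^ 'n ^ 'n"
  assumes "\<And>i j. i \<noteq> j \<Longrightarrow> A $ i $ j = 0"
  shows "(A *v v) $ i = A $ i $ i * v $ i"
proof -
  have "(\<Sum>j\<in>UNIV. A $ i $ j * v $ j) = (\<Sum>j\<in>UNIV. if j = i then A $ i $ i * v $ i else 0)"
    using assms by (intro sum.cong) auto
  then show ?thesis
    by (simp add: matrix_vector_mult_def)
qed

text \<open>The Euclidean norm is monotone in the absolute values of the components, so comparing
  with \<open>d *\<^sub>R v\<close> entry by entry suffices. This yields the bound on the speed of
  the flow.\<close>

lemma norm_diagonal_matrix_vector_mult_le:
  fixes A :: "real ^ 'n ^ 'n"
  assumes "\<And>i j. i \<noteq> j \<Longrightarrow> A $ i $ j = 0" and "\<And>i. \<bar>A $ i $ i\<bar> \<le> d"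
  shows "norm (A *v v) \<le> d * norm v"
proof -
  \<comment> \<open>Index types are nonempty, so some diagonal entry exists and its absolute value
    is at most \<open>d\<close>.\<close>
  have "d \<ge> 0"
    using assms(2) by (meson abs_ge_zero order_trans)
  have "norm (A *v v) \<le> norm (d *\<^sub>R v)"
  proof (rule norm_le_componentwise_cart)
    fix i
    show "norm ((A *v v) $ i) \<le> norm ((d *\<^sub>R v) $ i)"
      using assms \<open>d \<ge> 0\<close>
      by (simp add: diagonal_matrix_vector_mult_component abs_mult mult_right_mono)
  qed
  then show ?thesis
    using \<open>d \<ge> 0\<close> by simp
qed

text \<open>For a diagonal matrix the quadratic form is a sum of squares weighted by the diagonal
  entries. This yields the decay rate of \<open>f\<close> along the flow.\<close>

lemma inner_diagonal_matrix_vector_mult_ge: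
  fixes A :: "real ^ 'n ^ 'n"
  assumes "\<And>i j. i \<noteq> j \<Longrightarrow> A $ i $ j = 0" and "\<And>i. d \<le> A $ i $ i"
  shows "d * (norm v)\<^sup>2 \<le> (A *v v) \<bullet> v"
proof -
  have "d * (norm v)\<^sup>2 = (\<Sum>i\<in>UNIV. d * (v $ i * v $ i))"
    by (simp add: power2_norm_eq_inner inner_vec_def sum_distrib_left)
  also have "\<dots> \<le> (\<Sum>i\<in>UNIV. A $ i $ i * (v $ i * v $ i))"
    using assms by (intro sum_mono mult_right_mono) auto
  also have "\<dots> = (A *v v) \<bullet> v"
    using assms by (simp add: inner_vec_def diagonal_matrix_vector_mult_component mult.assoc)
  finally show ?thesis .
qed

theorem theorem3p4:
  fixes f :: "real ^ 'n \<Rightarrow> real"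
    and Z :: "real ^ 'n \<Rightarrow> real ^ 'n ^ 'n"
    and x :: "real \<Rightarrow> real ^ 'n"
    and x0 :: "real ^ 'n"
    and R L B d1 d2 :: real
  assumes Z_invertible: "\<And>y. invertible (Z y)"
    and A1_C2: "C2 f"
    and A1_R: "R > 0"
    and A1_bdd: "bdd_below (range f)"
    and A1_inf: "(INF y. f y) > - R"
    and A2: "filterlim f at_top at_infinity"
    and A3: "\<And>y. invertible (hessian f y)"
    and A4_pos: "L > 0" "B > 0"
    and A4_Lipschitz: "\<And>y z. norm (gradient f y - gradient f z) \<le> L * norm (y - z)"
    and A4_bounded: "\<And>y. norm (gradient f y) \<le> B"
    and A5_diagonal: "\<And>y i j. i \<noteq> j \<Longrightarrow> matrix_inv (Z y) $ i $ j = 0"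
    and A5_pos: "d1 > 0" "d2 > 0"
    and A5_bounds: "\<And>y i. d2 > matrix_inv (Z y) $ i $ i \<and> matrix_inv (Z y) $ i $ i > d1"
    and ode: "\<And>t. t \<ge> 0 \<Longrightarrow>
      (x has_vector_derivative - (matrix_inv (Z (x t)) *v gradient f (x t))) (at t within {0..})"
    and init: "x 0 = x0"
  shows "((\<lambda>t. norm (gradient f (x t))) \<longlongrightarrow> 0) at_top"
proof -
  define v where "v t = - (matrix_inv (Z (x t)) *v gradient f (x t))" for t
  have v_bound: "norm (v t) \<le> d2 * B" for t
  proof -
    have "\<bar>matrix_inv (Z (x t)) $ i $ i\<bar> \<le> d2" for i
      using A5_bounds [of "x t" i] A5_pos by auto
    then have "norm (v t) \<le> d2 * norm (gradient f (x t))"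
      unfolding v_def norm_minus_cancel
      by (intro norm_diagonal_matrix_vector_mult_le A5_diagonal)
    also have "\<dots> \<le> d2 * B"
      using A4_bounded A5_pos by (intro mult_left_mono) auto
    finally show ?thesis .
  qed
  have x_lipschitz: "norm (x t - x s) \<le> d2 * B * (t - s)" if "0 \<le> s" "s \<le> t" for s t
  proof -
    \<comment> \<open>Mean value inequality on the convex half-line: the derivative at
      \<open>u\<close> is the map sending \<open>h\<close> to \<open>h *\<^sub>R v u\<close>, whose
      operator norm is the speed \<open>norm (v u)\<close>.\<close>
    have "norm (x t - x s) \<le> d2 * B * norm (t - s)"
    proof (rule differentiable_bound [of "{0..}"])
      fix u :: real assume "u \<in> {0..}"
      then show "(x has_derivative (\<lambda>h. h *\<^sub>R v u)) (at u within {0..})"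
        using ode [of u] by (simp add: has_vector_derivative_def v_def)
      show "onorm (\<lambda>h. h *\<^sub>R v u) \<le> d2 * B"
        using v_bound [of u] by (simp add: onorm_scaleR_left [OF bounded_linear_ident] onorm_id)
    qed (use that in auto)
    then show ?thesis
      using that by simp
  qed
  show ?thesis
  \<comment> \<open>Applied with \<open>\<phi> = f \<circ> x\<close>, \<open>c = d1\<close> and
    \<open>K = L * (d2 * B)\<close>, the Lipschitz constant of the gradient times the speed
    bound.\<close>
  proof (rule dissipation_tendsto_zero)
    fix t :: real assume "t \<ge> 0"
    \<comment> \<open>The derivative of \<open>f\<close> is restricted to the image of the
      half-line, the form in which the one-sided chain rule takes the outer derivative.\<close>
    have "(f has_derivative (\<lambda>h. h \<bullet> gradient f (x t))) (at (x t) within x ` {0..})"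
      using GDERIV_gradient A1_C2
      by (auto simp: C2_def gderiv_def intro: has_derivative_at_withinI)
    with ode [OF \<open>t \<ge> 0\<close>]
    have "((f \<circ> x) has_vector_derivative v t \<bullet> gradient f (x t)) (at t within {0..})"
      unfolding v_def by (rule vector_derivative_diff_chain_within)
    then show "((f \<circ> x) has_real_derivative v t \<bullet> gradient f (x t)) (at t within {0..})"
      by (simp add: has_real_derivative_iff_has_vector_derivative)
    have "d1 * (norm (gradient f (x t)))\<^sup>2
        \<le> (matrix_inv (Z (x t)) *v gradient f (x t)) \<bullet> gradient f (x t)"
      using A5_bounds by (intro inner_diagonal_matrix_vector_mult_ge A5_diagonal less_imp_le) auto
    then show "v t \<bullet> gradient f (x t) \<le> - d1 * (norm (gradient f (x t)))\<^sup>2"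
      by (simp add: v_def)
  next
    fix s t :: real assume "0 \<le> s" "s \<le> t"
    have "\<bar>norm (gradient f (x t)) - norm (gradient f (x s))\<bar>
        \<le> norm (gradient f (x t) - gradient f (x s))"
      by (rule norm_triangle_ineq3)
    also have "\<dots> \<le> L * norm (x t - x s)"
      by (rule A4_Lipschitz)
    also have "\<dots> \<le> L * (d2 * B * (t - s))"
      using x_lipschitz [OF \<open>0 \<le> s\<close> \<open>s \<le> t\<close>] A4_pos by (intro mult_left_mono) auto
    finally show "\<bar>norm (gradient f (x t)) - norm (gradient f (x s))\<bar> \<le> L * (d2 * B) * (t - s)"
      by (simp add: mult.assoc)
  next
    show "bdd_below ((f \<circ> x) ` {0..})"
      using A1_bdd by (rule bdd_below_mono) auto
  qed (fact A5_pos)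
qed

end
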